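(* Let $f(s_1,s_2,s_3)$ be a $*$-Markov polynomial or a dual $*$-Markov polynomial of bi-degree $(d,q)$. Then $f(s_1,s_2,s_3)$ is a quasi-homogeneous polynomial with respect to weights $(1,2,3)$. Moreover, $|2q-3d|=1$ if $d$ is odd and $|2q-3d|=2$ if $d$ is even.
   Context: A Markov triple is a triple $(a,b,c)$ of positive integers with $a^2+b^2+c^2-abc=0$. Let $A=\mathbb Z[s_1,s_2,s_3^{\pm1}]$ with the ring involution $f^*(s_1,s_2,s_3)=f\left(\frac{s_2}{s_3},\frac{s_1}{s_3},\frac1{s_3}\right)$. The $*$-Markov equation for $(a,b,c)\in A^3$ is $aa^*+bb^*+cc^*-abc=\frac{3s_1s_2-s_1^3}{s_3}$. Its initial solution is $I=(s_1,\frac{s_1}{s_3},s_1)$. The evaluation map $\mathrm{Ev}:A^3\to\mathbb Z^3$ evaluates each coordinate at $s_1=3,s_2=3,s_3=1$. The $*$-Markov group $\Gamma_M$ is the group of transformations of $A^3$ generated by: $\lambda_{i,j}:(a,b,c)\mapsto((-1)^ia,(-1)^{i+j}b,(-1)^jc)$, $i,j\in\mathbb Z/2$; $\sigma_1:(a,b,c)\mapsto(b,a,c)$ and $\sigma_2:(a,b,c)\mapsto(a,c,b)$; $\tau_1:(a,b,c)\mapsto(-a^*,c^*,b^*-ac)$ and $\tau_2:(a,b,c)\mapsto(b^*,a^*-bc,-c^* )$; $\mu_{i,j}:(a,b,c)\mapsto(s_3^ia,s_3^{-i-j}b,s_3^jc)$, $i,j\in\mathbb Z$. $\Gamma_MI$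 is the orbit of $I$. A solution of the $*$-Markov equation written in the form $(f_1^*,f_2,f_3^* )$ is a reduced polynomial solution if each of $f_1,f_2,f_3$ is a nonconstant polynomial in $s_1,s_2,s_3$ not divisible by $s_3$; it is then a reduced polynomial presentation of the triple $\mathrm{Ev}(f_1^*,f_2,f_3^* )$. (Each Markov triple with $0<a<b$, $0<c<b$, $6\le b$ has a unique reduced polynomial presentation lying in $\Gamma_MI$.) For a polynomial $f(s_1,s_2,s_3)$, its bi-degree is $(d,q)$, where $d=\deg f$ is the degree with respect to weights $(1,1,1)$ of $(s_1,s_2,s_3)$ and $q=\mathrm{Deg} f$ is the degree with respect to weights $(1,2,3)$. For $f$ of degree $d=\deg f$ not divisible by $s_3$, put $\mu(f)=s_3^{d}f\left(\frac{s_2}{s_3},\frac{s_1}{s_3},\frac1{s_3}\right)$, a polynomial. Quasi-homogeneous with respect to weights $(1,2,3)$ means that all monomials $s_1^{a_1}s_2^{a_2}s_3^{a_3}$ occurring in the polynomial have the same value of $a_1+2a_2+3a_3$. A polynomial $P(s_1,s_2,s_3)$ is a $*$-Markov polynomial if $P=s_2$, or if there exists a Markov triple $(a,b,c)$ with $0<a<b$, $0<c<b$, $6\le b$ with reduced polynomial presentation $(f_1^*,f_2,f_3^* )\in\Gamma_MI$ such that $P=f_2$. A polynomial $Q(s_1,s_2,s_3)$ is a dual $*$-Markov polynomial if $Q$ is not divisible by $s_3$ and $\mu(Q)$ is a $*$-Markov polynomial. *)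

theory Defs
  imports
    "HOL-Library.Poly_Mapping"
    "HOL-Library.Product_Plus"
    "HOL-Algebra.Bij"
    "HOL-Algebra.Generated_Groups"
    "HOL-Algebra.Group_Action"
begin

section \<open>The ring \<open>A = \<int>[s\<^sub>1, s\<^sub>2, s\<^sub>3\<^sup>\<plusminus>]\<close>\<close>

text \<open>
  An exponent \<open>(i, j, k)\<close> stands for the monomial \<open>s\<^sub>1\<^sup>i s\<^sub>2\<^sup>j s\<^sub>3\<^sup>k\<close>; only the exponent of \<open>s\<^sub>3\<close>
  may be negative. Addition and the convolution product of the type are those of \<open>A\<close>.
\<close>

type_synonym laurent = "(nat \<times> nat \<times> int) \<Rightarrow>\<^sub>0 int"

definition s1 :: laurent where "s1 = Poly_Mapping.single (1, 0, 0) 1"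
definition s2 :: laurent where "s2 = Poly_Mapping.single (0, 1, 0) 1"

definition s3_pow :: "int \<Rightarrow> laurent"
  where "s3_pow k = Poly_Mapping.single (0, 0, k) 1"

abbreviation s3 :: laurent where "s3 \<equiv> s3_pow 1"

text \<open>
  \<open>subst x y z w f\<close> is \<open>f(x, y, z)\<close>, where \<open>w\<close> is meant to be the inverse of \<open>z\<close>.
  It is passed separately since the target is only a ring.
\<close>

definition subst :: "'r::comm_ring_1 \<Rightarrow> 'r \<Rightarrow> 'r \<Rightarrow> 'r \<Rightarrow> laurent \<Rightarrow> 'r"
  where "subst x y z w f =
    (\<Sum>(i, j, k) \<in> Poly_Mapping.keys f. of_int (Poly_Mapping.lookup f (i, j, k))
       * x ^ i * y ^ j * (if k \<ge> 0 then z ^ nat k else w ^ nat (- k)))"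

definition star :: "laurent \<Rightarrow> laurent"
  where "star = subst (s2 * s3_pow (-1)) (s1 * s3_pow (-1)) (s3_pow (-1)) s3"

lemma s3_pow_mult: "s3_pow i * s3_pow j = s3_pow (i + j)"
  by (simp add: s3_pow_def mult_single)

lemma s3_pow_0: "s3_pow 0 = 1"
proof -
  have "(0, 0, 0) = (0 :: nat \<times> nat \<times> int)" by (simp add: zero_prod_def)
  then show ?thesis by (simp add: s3_pow_def)
qed

lemma s3_pow_power: "s3_pow i ^ n = s3_pow (int n * i)"
  by (induction n) (simp_all add: s3_pow_0 s3_pow_mult algebra_simps)

lemma s1_power: "s1 ^ n = Poly_Mapping.single (n, 0, 0) 1"
proof (induction n)
  case 0
  have "(0, 0, 0) = (0 :: nat \<times> nat \<times> int)" by (simp add: zero_prod_def)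
  then show ?case by simp
qed (simp add: s1_def mult_single)

lemma s2_power: "s2 ^ n = Poly_Mapping.single (0, n, 0) 1"
proof (induction n)
  case 0
  have "(0, 0, 0) = (0 :: nat \<times> nat \<times> int)" by (simp add: zero_prod_def)
  then show ?case by simp
qed (simp add: s2_def mult_single)

lemma of_int_mult_single:
  "of_int c * Poly_Mapping.single e 1 = (Poly_Mapping.single e c :: laurent)"
proof -
  have "of_int c = (Poly_Mapping.single 0 c :: laurent)"
    by (metis of_int_eq_id id_apply single_of_int)
  then show ?thesis by (simp add: mult_single)
qed

lemma star_alt:
  "star f = (\<Sum>(i, j, k) \<in> Poly_Mapping.keys f.
     Poly_Mapping.single (j, i, - int i - int j - k) (Poly_Mapping.lookup f (i, j, k)))"
proof -
  have "(s2 * s3_pow (-1)) ^ i * (s1 * s3_pow (-1)) ^ j *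
      (if k \<ge> 0 then s3_pow (-1) ^ nat k else s3 ^ nat (- k))
      = Poly_Mapping.single (j, i, - int i - int j - k) 1" for i j k
    by (simp add: power_mult_distrib s1_power s2_power s3_pow_power)
       (simp add: s3_pow_def mult_single)
  then show ?thesis
    unfolding star_def subst_def
    by (intro sum.cong) (auto simp: mult.assoc of_int_mult_single)
qed

lemma lookup_star:
  "Poly_Mapping.lookup (star f) (i, j, k) = Poly_Mapping.lookup f (j, i, - int i - int j - k)"
proof -
  have "Poly_Mapping.lookup (star f) (i, j, k) = (\<Sum>e \<in> Poly_Mapping.keys f.
      if e = (j, i, - int i - int j - k) then Poly_Mapping.lookup f e else 0)"
    unfolding star_alt lookup_sum
    by (intro sum.cong) (auto simp: lookup_single when_def split: if_splits)
  also have "\<dots> = Poly_Mapping.lookup f (j, i, - int i - int j - k)"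
    by (simp add: sum.delta in_keys_iff)
  finally show ?thesis .
qed

lemma star_star: "star (star f) = f"
  by (rule poly_mapping_eqI) (auto simp: lookup_star)

lemma star_uminus: "star (- f) = - star f"
  by (rule poly_mapping_eqI) (auto simp: lookup_star)

section \<open>Solutions of the equation\<close>

type_synonym triple = "laurent \<times> laurent \<times> laurent"

definition markov_triple :: "int \<times> int \<times> int \<Rightarrow> bool"
  where "markov_triple = (\<lambda>(a, b, c). a > 0 \<and> b > 0 \<and> c > 0 \<and> a^2 + b^2 + c^2 - a * b * c = 0)"

definition star_markov_solution :: "triple \<Rightarrow> bool"
  where "star_markov_solution = (\<lambda>(a, b, c).
    a * star a + b * star b + c * star c - a * b * c = (3 * s1 * s2 - s1 ^ 3) * s3_pow (-1))"

definition initial_solution :: triple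
  where "initial_solution = (s1, s1 * s3_pow (-1), s1)"

definition Ev :: "triple \<Rightarrow> int \<times> int \<times> int"
  where "Ev = (\<lambda>(a, b, c). (subst 3 3 1 1 a, subst 3 3 1 1 b, subst 3 3 1 1 c))"

section \<open>The group of transformations and the orbit\<close>

definition lambda_map :: "nat \<Rightarrow> nat \<Rightarrow> triple \<Rightarrow> triple"
  where "lambda_map i j = (\<lambda>(a, b, c). ((-1) ^ i * a, (-1) ^ (i + j) * b, (-1) ^ j * c))"

definition sigma1 :: "triple \<Rightarrow> triple" where "sigma1 = (\<lambda>(a, b, c). (b, a, c))"
definition sigma2 :: "triple \<Rightarrow> triple" where "sigma2 = (\<lambda>(a, b, c). (a, c, b))"

definition tau1 :: "triple \<Rightarrow> triple"
  where "tau1 = (\<lambda>(a, b, c). (- star a, star c, star b - a * c))"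

definition tau2 :: "triple \<Rightarrow> triple"
  where "tau2 = (\<lambda>(a, b, c). (star b, star a - b * c, - star c))"

definition mu_map :: "int \<Rightarrow> int \<Rightarrow> triple \<Rightarrow> triple"
  where "mu_map i j = (\<lambda>(a, b, c). (s3_pow i * a, s3_pow (- i - j) * b, s3_pow j * c))"

definition Gamma_generators :: "(triple \<Rightarrow> triple) set"
  where "Gamma_generators =
    {lambda_map i j | i j. True} \<union> {sigma1, sigma2, tau1, tau2} \<union> {mu_map i j | i j. True}"

text \<open>
  The generators are bijective, so \<open>Gamma_M\<close> is a subgroup of the group of all
  bijections of \<open>A\<^sup>3\<close>.
\<close>

lemma Gamma_generators_subset: "Gamma_generators \<subseteq> carrier (BijGroup UNIV)"
proof -
  have *: "h \<in> carrier (BijGroup UNIV)"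
    if "\<And>t. g (h t) = t" "\<And>t. h (g t) = t" for g h :: "triple \<Rightarrow> triple"
    using that by (auto simp: BijGroup_def Bij_def intro!: bij_betw_byWitness[where f' = g])
  have sgn: "(-1) ^ n * ((-1) ^ n * a) = a" for n and a :: laurent
    by (simp flip: mult.assoc power_add power_mult_distrib)
  have "lambda_map i j \<in> carrier (BijGroup UNIV)" for i j
    by (rule *[of "lambda_map i j"]) (auto simp: lambda_map_def sgn)
  moreover have "sigma1 \<in> carrier (BijGroup UNIV)"
    by (rule *[of sigma1]) (auto simp: sigma1_def)
  moreover have "sigma2 \<in> carrier (BijGroup UNIV)"
    by (rule *[of sigma2]) (auto simp: sigma2_def)
  moreover have "tau1 \<in> carrier (BijGroup UNIV)"
    by (rule *[of "\<lambda>(x, y, z). (- star x, star (z - star x * star y), star y)"])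
       (auto simp: tau1_def star_star star_uminus)
  moreover have "tau2 \<in> carrier (BijGroup UNIV)"
    by (rule *[of "\<lambda>(x, y, z). (star (y - star x * star z), star x, - star z)"])
       (auto simp: tau2_def star_star star_uminus)
  moreover have "mu_map i j \<in> carrier (BijGroup UNIV)" for i j
    by (rule *[of "mu_map (- i) (- j)"])
       (auto simp: mu_map_def s3_pow_mult s3_pow_0 simp flip: mult.assoc)
  ultimately show ?thesis
    by (auto simp: Gamma_generators_def)
qed

definition Gamma_M :: "(triple \<Rightarrow> triple) set"
  where "Gamma_M = generate (BijGroup UNIV) Gamma_generators"

definition Gamma_orbit :: "triple set"
  where "Gamma_orbit = orbit ((BijGroup UNIV)\<lparr>carrier := Gamma_M\<rparr>) (\<lambda>g. g) initial_solution"

section \<open>Polynomials, degrees and quasi-homogeneity\<close>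

text \<open>The subring \<open>\<int>[s\<^sub>1, s\<^sub>2, s\<^sub>3]\<close> of \<open>A\<close>.\<close>

definition polynomials :: "laurent set"
  where "polynomials = {f. \<forall>(i, j, k) \<in> Poly_Mapping.keys f. k \<ge> 0}"

text \<open>Divisibility in \<open>\<int>[s\<^sub>1, s\<^sub>2, s\<^sub>3]\<close>, as opposed to \<open>A\<close>, where \<open>s\<^sub>3\<close> is a unit.\<close>

definition divisible_by_s3 :: "laurent \<Rightarrow> bool"
  where "divisible_by_s3 f \<longleftrightarrow> (\<exists>g \<in> polynomials. f = s3 * g)"

definition is_constant :: "laurent \<Rightarrow> bool"
  where "is_constant f \<longleftrightarrow> (\<exists>n. f = of_int n)"

definition weight :: "int \<times> int \<times> int \<Rightarrow> nat \<times> nat \<times> int \<Rightarrow> int"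
  where "weight = (\<lambda>(w1, w2, w3) (i, j, k). w1 * int i + w2 * int j + w3 * k)"

text \<open>The weighted degree is meaningful only for \<open>f \<noteq> 0\<close>.\<close>

definition wdegree :: "int \<times> int \<times> int \<Rightarrow> laurent \<Rightarrow> int"
  where "wdegree w f = Max (weight w ` Poly_Mapping.keys f)"

definition bidegree :: "laurent \<Rightarrow> int \<times> int"
  where "bidegree f = (wdegree (1, 1, 1) f, wdegree (1, 2, 3) f)"

definition quasi_homogeneous :: "int \<times> int \<times> int \<Rightarrow> laurent \<Rightarrow> bool"
  where "quasi_homogeneous w f \<longleftrightarrow>
    (\<forall>e \<in> Poly_Mapping.keys f. \<forall>e' \<in> Poly_Mapping.keys f. weight w e = weight w e')"

definition mu_dual :: "laurent \<Rightarrow> laurent"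
  where "mu_dual f = s3_pow (wdegree (1, 1, 1) f) * star f"

section \<open>Reduced presentations and the distinguished polynomials\<close>

definition reduced_polynomial_solution :: "laurent \<Rightarrow> laurent \<Rightarrow> laurent \<Rightarrow> bool"
  where "reduced_polynomial_solution f1 f2 f3 \<longleftrightarrow>
    star_markov_solution (star f1, f2, star f3) \<and>
    (\<forall>f \<in> {f1, f2, f3}. f \<in> polynomials \<and> \<not> is_constant f \<and> \<not> divisible_by_s3 f)"

definition reduced_polynomial_presentation ::
    "int \<times> int \<times> int \<Rightarrow> laurent \<Rightarrow> laurent \<Rightarrow> laurent \<Rightarrow> bool"
  where "reduced_polynomial_presentation t f1 f2 f3 \<longleftrightarrow>
    reduced_polynomial_solution f1 f2 f3 \<and> Ev (star f1, f2, star f3) = t"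

definition star_markov_polynomial :: "laurent \<Rightarrow> bool"
  where "star_markov_polynomial P \<longleftrightarrow> P = s2 \<or>
    (\<exists>a b c f1 f2 f3. markov_triple (a, b, c) \<and> 0 < a \<and> a < b \<and> 0 < c \<and> c < b \<and> 6 \<le> b \<and>
       reduced_polynomial_presentation (a, b, c) f1 f2 f3 \<and>
       (star f1, f2, star f3) \<in> Gamma_orbit \<and> P = f2)"

definition dual_star_markov_polynomial :: "laurent \<Rightarrow> bool"
  where "dual_star_markov_polynomial Q \<longleftrightarrow>
    Q \<in> polynomials \<and> \<not> divisible_by_s3 Q \<and> star_markov_polynomial (mu_dual Q)"

end

theory Submission
  imports Defs "HOL-Library.Product_Lexorder"
begin

text \<open>
  Two gradings blind to \<open>s\<^sub>3\<close> carry the proof: let \<open>Y f\<close> and \<open>X f\<close> be the degrees of \<open>f\<close> for the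
  weights \<open>(1, 2, 0)\<close> and \<open>(2, 1, 0)\<close>. The involution of \<open>A\<close> exchanges \<open>X\<close> and \<open>Y\<close> and negates the
  weights \<open>(1, 2, 3)\<close>. If \<open>f\<close> is a quasi-homogeneous polynomial not divisible by \<open>s\<^sub>3\<close>, some monomial
  of \<open>f\<close> is free of \<open>s\<^sub>3\<close>, so \<open>Y f = q\<close>; and \<open>(2, 1, 0) = 3 (1, 1, 1) - (1, 2, 3)\<close> gives
  \<open>X f = 3 d - q\<close>. Hence \<open>2 q - 3 d\<close> is the defect \<open>Y f - X f\<close> (lemma \<open>defect_eq_bidegree\<close>). It has
  the parity of \<open>d\<close>, so it suffices to show that \<open>f\<close> is quasi-homogeneous with defect \<open>\<plusminus>1\<close> or \<open>\<plusminus>2\<close>.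
  Both properties pass to the dual polynomial, because the involution and powers of \<open>s\<^sub>3\<close> change
  the defect at most by a sign.

  Up to permutations, signs and powers of \<open>s\<^sub>3\<close>, the group \<open>Gamma_M\<close> is generated by one involutive
  mutation \<open>(a, b, c) \<mapsto> (a\<^sup>* - b c, b\<^sup>*, - c\<^sup>*)\<close>. It keeps the three components homogeneous with
  weights of sum zero, since then \<open>a\<^sup>*\<close> and \<open>b c\<close> have the same weight. For the defects, call the
  first component of a triple dominant if \<open>Y a = X b + X c\<close> and \<open>X a = Y b + Y c\<close>, with \<open>X\<close> and \<open>Y\<close> of
  \<open>b\<close> and \<open>c\<close> positive. If another component is dominant, then \<open>b c\<close> exceeds \<open>a\<^sup>*\<close> in both gradings;
  no leading term cancels, the new first component is dominant again, and all three defects are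
  negated.

  Such ascending mutations build a tree above the initial solution, all of whose defects are
  \<open>-1\<close>, and whose first mutation has defects \<open>-2, 1, 1\<close>. The remaining mutations need no analysis
  of cancellation: mutating the dominant component undoes the step that created the triple.
  So the tree is closed under the whole group (lemma \<open>markov_tree_mutations\<close>) and contains
  the orbit.
\<close>

section \<open>Weighted degrees\<close>

lemma weight_add: "weight w (e + e') = weight w e + weight w e'"
  by (cases w; cases e; cases e') (simp add: weight_def algebra_simps)

lemma wdegree_eqI:
  assumes "e \<in> Poly_Mapping.keys f" "\<And>e'. e' \<in> Poly_Mapping.keys f \<Longrightarrow> weight w e' \<le> weight w e"
  shows "wdegree w f = weight w e"
  unfolding wdegree_def using assms by (intro Max_eqI) auto

lemma wdegree_witness:
  assumes "f \<noteq> 0"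
  obtains e where "e \<in> Poly_Mapping.keys f" "wdegree w f = weight w e"
proof -
  have "wdegree w f \<in> weight w ` Poly_Mapping.keys f"
    unfolding wdegree_def using assms by (intro Max_in) auto
  then show thesis using that by auto
qed

lemma weight_le_wdegree: "e \<in> Poly_Mapping.keys f \<Longrightarrow> weight w e \<le> wdegree w f"
  unfolding wdegree_def by (intro Max_ge) auto

lemma wdegree_single: "c \<noteq> 0 \<Longrightarrow> wdegree w (Poly_Mapping.single e c) = weight w e"
  by (simp add: wdegree_def)

lemma wdegree_uminus: "wdegree w (- f) = wdegree w f"
  by (simp add: wdegree_def)

text \<open>
  Several monomials may attain the weighted degree, and their products could cancel. Breaking
  ties lexicographically singles out one leading monomial.
\<close>

definition monomial_rank :: "int \<times> int \<times> int \<Rightarrow> nat \<times> nat \<times> int \<Rightarrow> int \<times> nat \<times> nat \<times> int"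
  where "monomial_rank w e = (weight w e, e)"

lemma monomial_rank_add_less:
  assumes "monomial_rank w e1 < monomial_rank w e" "monomial_rank w e2 \<le> monomial_rank w e'"
  shows "monomial_rank w (e1 + e2) < monomial_rank w (e + e')"
proof -
  have "(x, a) < (y, b) \<Longrightarrow> (x', a') \<le> (y', b') \<Longrightarrow> (x + x', a + a') < (y + y', b + b')"
    for x y x' y' :: int and a b a' b' :: "nat \<times> nat \<times> int"
    by (cases a; cases b; cases a'; cases b') auto
  then show ?thesis using assms unfolding monomial_rank_def weight_add by blast
qed

text \<open>
  Split off the monomial of largest rank. Ranks are distinct for distinct monomials, so what
  remains lies strictly below it.
\<close>
lemma leading_monomial:
  fixes f :: laurent
  assumes "f \<noteq> 0"
  obtains e c g where "f = Poly_Mapping.single e c + g" "c \<noteq> 0" "e \<in> Poly_Mapping.keys f"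
    "\<And>e'. e' \<in> Poly_Mapping.keys g \<Longrightarrow> monomial_rank w e' < monomial_rank w e"
    "\<And>e'. e' \<in> Poly_Mapping.keys f \<Longrightarrow> monomial_rank w e' \<le> monomial_rank w e"
proof -
  have "Max (monomial_rank w ` Poly_Mapping.keys f) \<in> monomial_rank w ` Poly_Mapping.keys f"
    using assms by (intro Max_in) auto
  then obtain e where e: "e \<in> Poly_Mapping.keys f"
    and max: "Max (monomial_rank w ` Poly_Mapping.keys f) = monomial_rank w e" by auto
  have le: "monomial_rank w e' \<le> monomial_rank w e" if "e' \<in> Poly_Mapping.keys f" for e'
    using that by (metis Max_ge finite_imageI finite_keys image_eqI max)
  define c where "c = Poly_Mapping.lookup f e"
  define g where "g = f - Poly_Mapping.single e c"
  have keys_g: "Poly_Mapping.keys g \<subseteq> Poly_Mapping.keys f - {e}"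
    by (auto simp: g_def c_def in_keys_iff lookup_minus lookup_single when_def split: if_splits)
  have "monomial_rank w e' < monomial_rank w e" if "e' \<in> Poly_Mapping.keys g" for e'
  proof -
    have "e' \<in> Poly_Mapping.keys f" "e' \<noteq> e" using that keys_g by auto
    then show ?thesis
      using le[of e'] by (auto simp: order.order_iff_strict monomial_rank_def)
  qed
  moreover have "c \<noteq> 0" using e by (simp add: c_def in_keys_iff)
  moreover have "f = Poly_Mapping.single e c + g" by (simp add: g_def)
  ultimately show thesis using that e le by blast
qed

text \<open>
  The product of the two leading monomials is the only contribution of its rank to the product,
  and \<open>\<int>\<close> has no zero divisors, so it survives.
\<close>
lemma wdegree_mult:
  fixes f g :: laurent
  assumes "f \<noteq> 0" "g \<noteq> 0"
  shows "f * g \<noteq> 0" and "wdegree w (f * g) = wdegree w f + wdegree w g"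
proof -
  obtain e c f' where f: "f = Poly_Mapping.single e c + f'" "c \<noteq> 0" "e \<in> Poly_Mapping.keys f"
    "\<And>u. u \<in> Poly_Mapping.keys f' \<Longrightarrow> monomial_rank w u < monomial_rank w e"
    "\<And>u. u \<in> Poly_Mapping.keys f \<Longrightarrow> monomial_rank w u \<le> monomial_rank w e"
    using leading_monomial[OF assms(1)] by metis
  obtain e' c' g' where g: "g = Poly_Mapping.single e' c' + g'" "c' \<noteq> 0" "e' \<in> Poly_Mapping.keys g"
    "\<And>u. u \<in> Poly_Mapping.keys g' \<Longrightarrow> monomial_rank w u < monomial_rank w e'"
    "\<And>u. u \<in> Poly_Mapping.keys g \<Longrightarrow> monomial_rank w u \<le> monomial_rank w e'"
    using leading_monomial[OF assms(2)] by metis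
  define r where "r = f' * g + Poly_Mapping.single e c * g'"
  have fg: "f * g = Poly_Mapping.single (e + e') (c * c') + r"
  proof -
    have "f * g = f' * g + Poly_Mapping.single e c * g"
      by (subst f(1)) (simp add: algebra_simps)
    also have "Poly_Mapping.single e c * g = Poly_Mapping.single (e + e') (c * c') + Poly_Mapping.single e c * g'"
      by (subst g(1)) (simp add: algebra_simps mult_single)
    finally show ?thesis by (simp add: r_def algebra_simps)
  qed
  have r: "monomial_rank w u < monomial_rank w (e + e')" if "u \<in> Poly_Mapping.keys r" for u
  proof -
    have "u \<in> Poly_Mapping.keys (f' * g) \<or> u \<in> Poly_Mapping.keys (Poly_Mapping.single e c * g')"
      using that keys_add[of "f' * g"] unfolding r_def by blast
    then show ?thesis
    proof
      assume "u \<in> Poly_Mapping.keys (f' * g)"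
      then obtain u1 u2 where "u = u1 + u2" "u1 \<in> Poly_Mapping.keys f'" "u2 \<in> Poly_Mapping.keys g"
        using keys_mult[of f' g] by blast
      then show ?thesis using monomial_rank_add_less f(4) g(5) by blast
    next
      assume "u \<in> Poly_Mapping.keys (Poly_Mapping.single e c * g')"
      then obtain u2 where u: "u = e + u2" "u2 \<in> Poly_Mapping.keys g'"
        using keys_mult[of "Poly_Mapping.single e c" g'] f(2) by auto
      have "monomial_rank w (u2 + e) < monomial_rank w (e' + e)"
        using g(4)[OF u(2)] by (intro monomial_rank_add_less) auto
      then show ?thesis using u by (simp add: add.commute)
    qed
  qed
  have "e + e' \<notin> Poly_Mapping.keys r" using r by blast
  then have key: "e + e' \<in> Poly_Mapping.keys (f * g)"
    using f(2) g(2) by (simp add: fg in_keys_iff lookup_add)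
  then show "f * g \<noteq> 0" by auto
  \<comment> \<open>The rank refines the weight, so maximal rank gives maximal weight.\<close>
  have weight_le: "weight w u \<le> weight w v" if "monomial_rank w u \<le> monomial_rank w v" for u v
    using that by (auto simp: monomial_rank_def)
  have "weight w u \<le> weight w (e + e')" if "u \<in> Poly_Mapping.keys (f * g)" for u
  proof -
    have "u = e + e' \<or> u \<in> Poly_Mapping.keys r"
      using that keys_add[of "Poly_Mapping.single (e + e') (c * c')" r] unfolding fg
      by (auto split: if_splits)
    then show ?thesis using r weight_le by (metis order.strict_implies_order order_refl)
  qed
  then have "wdegree w (f * g) = weight w (e + e')" by (intro wdegree_eqI key)
  moreover have "wdegree w f = weight w e" using f by (intro wdegree_eqI weight_le) auto
  moreover have "wdegree w g = weight w e'" using g by (intro wdegree_eqI weight_le) auto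
  ultimately show "wdegree w (f * g) = wdegree w f + wdegree w g" by (simp add: weight_add)
qed

lemma wdegree_diff_dominated:
  assumes "g \<noteq> 0" "wdegree w f < wdegree w g"
  shows "f - g \<noteq> 0" and "wdegree w (f - g) = wdegree w g"
proof -
  obtain e where e: "e \<in> Poly_Mapping.keys g" "wdegree w g = weight w e"
    using wdegree_witness[OF assms(1)] .
  have "e \<notin> Poly_Mapping.keys f"
    using weight_le_wdegree[of e f w] assms(2) e(2) by auto
  then have key: "e \<in> Poly_Mapping.keys (f - g)"
    using e(1) by (simp add: in_keys_iff lookup_minus)
  then show "f - g \<noteq> 0" by auto
  have "weight w u \<le> weight w e" if "u \<in> Poly_Mapping.keys (f - g)" for u
  proof -
    have "u \<in> Poly_Mapping.keys f \<or> u \<in> Poly_Mapping.keys g"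
      using that by (auto simp: in_keys_iff lookup_minus)
    then show ?thesis
      using weight_le_wdegree[of u f w] weight_le_wdegree[of u g w] assms(2) e(2) by auto
  qed
  then show "wdegree w (f - g) = wdegree w g"
    using e(2) wdegree_eqI[OF key, of w] by simp
qed

section \<open>The involution\<close>

lemma star_diff: "star (f - g) = star f - star g"
  by (rule poly_mapping_eqI) (auto simp: lookup_star lookup_minus)

lemma star_zero: "star 0 = 0"
  by (rule poly_mapping_eqI) (auto simp: lookup_star)

lemma star_eq_0_iff: "star f = 0 \<longleftrightarrow> f = 0"
  by (metis star_star star_zero)

lemma star_single:
  "star (Poly_Mapping.single (i, j, k) c) = Poly_Mapping.single (j, i, - int i - int j - k) c"
  by (rule poly_mapping_eqI) (auto simp: lookup_star lookup_single when_def split: if_splits)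

text \<open>
  As an additive group, \<open>A\<close> is free on its monomials, so multiplicativity has to be checked on
  products of monomials only.
\<close>
lemma star_mult: "star (f * g) = star f * star g"
proof -
  have single: "star (frag_of e * frag_of e') = star (frag_of e) * star (frag_of e')" for e e'
    by (cases e; cases e') (simp add: mult_single star_single algebra_simps)
  have "Poly_Mapping.keys g \<subseteq> UNIV" by simp
  then have frag_of_left: "star (frag_of e * g) = star (frag_of e) * star g" for e
    by (induction g rule: frag_induction)
       (simp_all add: single star_zero star_diff right_diff_distrib)
  have "Poly_Mapping.keys f \<subseteq> UNIV" by simp
  then show ?thesis
    by (induction f rule: frag_induction) (simp_all add: frag_of_left star_zero star_diff left_diff_distrib)
qed

lemma star_s3_pow: "star (s3_pow k) = s3_pow (- k)"
  by (simp add: s3_pow_def star_single)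

lemma keys_star:
  "Poly_Mapping.keys (star f) = (\<lambda>(i, j, k). (j, i, - int i - int j - k)) ` Poly_Mapping.keys f"
  (is "_ = ?h ` _")
proof -
  have hh: "?h (?h e) = e" for e by (cases e) simp
  have "e \<in> Poly_Mapping.keys (star f) \<longleftrightarrow> ?h e \<in> Poly_Mapping.keys f" for e
    by (cases e) (simp add: in_keys_iff lookup_star)
  then show ?thesis by (metis (no_types, lifting) hh image_iff subsetI subset_antisym)
qed

section \<open>The defect\<close>

abbreviation wdeg12 :: "laurent \<Rightarrow> int" where "wdeg12 \<equiv> wdegree (1, 2, 0)"
abbreviation wdeg21 :: "laurent \<Rightarrow> int" where "wdeg21 \<equiv> wdegree (2, 1, 0)"

definition defect :: "laurent \<Rightarrow> int" where "defect f = wdeg12 f - wdeg21 f"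

text \<open>
  The involution exchanges \<open>s\<^sub>1\<close> and \<open>s\<^sub>2\<close> up to powers of \<open>s\<^sub>3\<close>, which have weight 0 here.
\<close>
lemma wdeg_star: "wdeg12 (star f) = wdeg21 f" "wdeg21 (star f) = wdeg12 f"
proof -
  have "weight (1, 2, 0) ` Poly_Mapping.keys (star f) = weight (2, 1, 0) ` Poly_Mapping.keys f"
    "weight (2, 1, 0) ` Poly_Mapping.keys (star f) = weight (1, 2, 0) ` Poly_Mapping.keys f"
    unfolding keys_star image_image by (auto simp: weight_def intro!: image_cong)
  then show "wdeg12 (star f) = wdeg21 f" "wdeg21 (star f) = wdeg12 f"
    by (simp_all add: wdegree_def)
qed

lemma s3_pow_nonzero: "s3_pow k \<noteq> 0"
  by (metis mult_zero_left s3_pow_0 s3_pow_mult add.right_inverse zero_neq_one)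

lemma s3_pow_mult_eq_0_iff: "s3_pow k * f = 0 \<longleftrightarrow> f = 0"
  using wdegree_mult(1)[OF s3_pow_nonzero] by auto

lemma wdeg_s3_pow_mult: "wdegree (w1, w2, 0) (s3_pow k * f) = wdegree (w1, w2, 0) f"
proof (cases "f = 0")
  case False
  then show ?thesis
    by (simp add: wdegree_mult s3_pow_nonzero) (simp add: s3_pow_def wdegree_single weight_def)
qed simp

lemma defect_star: "defect (star f) = - defect f"
  by (simp add: defect_def wdeg_star)

lemma defect_uminus: "defect (- f) = defect f"
  by (simp add: defect_def wdegree_uminus)

lemma defect_s3_pow_mult: "defect (s3_pow k * f) = defect f"
  by (simp add: defect_def wdeg_s3_pow_mult)

definition homogeneous_of_weight :: "int \<Rightarrow> laurent \<Rightarrow> bool"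
  where "homogeneous_of_weight p f \<longleftrightarrow> (\<forall>e \<in> Poly_Mapping.keys f. weight (1, 2, 3) e = p)"

lemma quasi_homogeneous_iff: "quasi_homogeneous (1, 2, 3) f \<longleftrightarrow> (\<exists>p. homogeneous_of_weight p f)"
  unfolding quasi_homogeneous_def homogeneous_of_weight_def by metis

lemma homogeneous_of_weight_mult:
  "homogeneous_of_weight p f \<Longrightarrow> homogeneous_of_weight r g \<Longrightarrow> homogeneous_of_weight (p + r) (f * g)"
  unfolding homogeneous_of_weight_def
  using keys_mult[of f g] by (auto simp: weight_add simp del: add_Pair dest!: subsetD)

lemma homogeneous_of_weight_diff:
  "homogeneous_of_weight p f \<Longrightarrow> homogeneous_of_weight p g \<Longrightarrow> homogeneous_of_weight p (f - g)"
  unfolding homogeneous_of_weight_def by (auto simp: in_keys_iff lookup_minus)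

lemma homogeneous_of_weight_uminus:
  "homogeneous_of_weight p (- f) \<longleftrightarrow> homogeneous_of_weight p f"
  by (simp add: homogeneous_of_weight_def)

text \<open>
  Under the weights \<open>(1, 2, 3)\<close> the images \<open>s\<^sub>2/s\<^sub>3\<close>, \<open>s\<^sub>1/s\<^sub>3\<close>, \<open>1/s\<^sub>3\<close> have weights \<open>-1, -2, -3\<close>.
\<close>
lemma homogeneous_of_weight_star:
  "homogeneous_of_weight p f \<Longrightarrow> homogeneous_of_weight (- p) (star f)"
  unfolding homogeneous_of_weight_def keys_star by (auto simp: weight_def)

lemma homogeneous_of_weight_single: "homogeneous_of_weight (weight (1, 2, 3) e) (Poly_Mapping.single e c)"
  by (simp add: homogeneous_of_weight_def)

lemma homogeneous_of_weight_s3_pow_mult: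
  assumes "homogeneous_of_weight p f"
  shows "homogeneous_of_weight (3 * k + p) (s3_pow k * f)"
proof -
  have "homogeneous_of_weight (3 * k) (s3_pow k)"
    using homogeneous_of_weight_single[of "(0, 0, k)" 1] by (simp add: s3_pow_def weight_def)
  then show ?thesis by (rule homogeneous_of_weight_mult[OF _ assms])
qed

text \<open>
  On monomials of \<open>(1, 2, 3)\<close>-weight \<open>q\<close>, the weight \<open>(1, 2, 0)\<close> is \<open>q - 3 k\<close> with \<open>k \<ge> 0\<close> the exponent
  of \<open>s\<^sub>3\<close>. Since \<open>s\<^sub>3\<close> does not divide \<open>f\<close>, the value \<open>k = 0\<close> occurs and the maximum is \<open>q\<close>. The weight
  \<open>(2, 1, 0)\<close> is three times the ordinary degree minus \<open>q\<close>.
\<close>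
lemma defect_eq_bidegree:
  assumes "f \<in> polynomials" "\<not> divisible_by_s3 f" "quasi_homogeneous (1, 2, 3) f"
    and "bidegree f = (d, q)"
  shows "defect f = 2 * q - 3 * d"
proof -
  have "\<exists>i j. (i, j, 0) \<in> Poly_Mapping.keys f"
  proof (rule ccontr)
    assume none: "\<nexists>i j. (i, j, 0) \<in> Poly_Mapping.keys f"
    have quotient_key: "(i, j, k + 1) \<in> Poly_Mapping.keys f"
      if "(i, j, k) \<in> Poly_Mapping.keys (s3_pow (-1) * f)" for i j k
    proof -
      have "(i, j, k) \<in> {a + b |a b. a \<in> Poly_Mapping.keys (s3_pow (-1)) \<and> b \<in> Poly_Mapping.keys f}"
        using that keys_mult[of "s3_pow (-1)" f] by blast
      then show ?thesis by (auto simp: s3_pow_def)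
    qed
    have "k \<ge> 0" if "(i, j, k) \<in> Poly_Mapping.keys (s3_pow (-1) * f)" for i j k
    proof -
      have "k + 1 \<ge> 0" "k + 1 \<noteq> 0"
        using quotient_key[OF that] assms(1) none by (auto simp: polynomials_def)
      then show ?thesis by simp
    qed
    then have "s3_pow (-1) * f \<in> polynomials" by (auto simp: polynomials_def)
    moreover have "f = s3 * (s3_pow (-1) * f)"
      by (simp add: s3_pow_mult s3_pow_0 flip: mult.assoc)
    ultimately show False using assms(2) by (auto simp: divisible_by_s3_def)
  qed
  then obtain i j where ij: "(i, j, 0) \<in> Poly_Mapping.keys f" by blast
  then have "f \<noteq> 0" by auto
  have hom: "weight (1, 2, 3) e = q" if "e \<in> Poly_Mapping.keys f" for e
  proof -
    obtain e' where e': "e' \<in> Poly_Mapping.keys f" "wdegree (1, 2, 3) f = weight (1, 2, 3) e'"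
      using wdegree_witness[OF \<open>f \<noteq> 0\<close>] .
    have "weight (1, 2, 3) e = weight (1, 2, 3) e'"
      using assms(3) that e'(1) unfolding quasi_homogeneous_def by blast
    also have "\<dots> = q" using assms(4) e'(2) by (simp add: bidegree_def)
    finally show ?thesis .
  qed
  have "wdeg12 f = weight (1, 2, 0) (i, j, 0)"
  proof (rule wdegree_eqI[OF ij])
    fix e assume e: "e \<in> Poly_Mapping.keys f"
    then show "weight (1, 2, 0) e \<le> weight (1, 2, 0) (i, j, 0)"
      using hom[OF e] hom[OF ij] assms(1) by (cases e) (auto simp: weight_def polynomials_def)
  qed
  then have "wdeg12 f = q" using hom[OF ij] by (simp add: weight_def)
  moreover have "wdeg21 f = 3 * d - q"
  proof -
    obtain e where e: "e \<in> Poly_Mapping.keys f" "wdegree (1, 1, 1) f = weight (1, 1, 1) e"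
      using wdegree_witness[OF \<open>f \<noteq> 0\<close>] .
    have eq: "weight (2, 1, 0) u = 3 * weight (1, 1, 1) u - q" if "u \<in> Poly_Mapping.keys f" for u
      using hom[OF that] by (cases u) (simp add: weight_def)
    have "wdeg21 f = weight (2, 1, 0) e"
    proof (rule wdegree_eqI[OF e(1)])
      fix u assume u: "u \<in> Poly_Mapping.keys f"
      show "weight (2, 1, 0) u \<le> weight (2, 1, 0) e"
        using weight_le_wdegree[OF u, of "(1, 1, 1)"] e by (simp add: eq u)
    qed
    then show ?thesis using eq e assms(4) by (simp add: bidegree_def)
  qed
  ultimately show ?thesis by (simp add: defect_def)
qed

section \<open>Mutations\<close>

text \<open>
  The sign of the last component makes the map involutive:
  \<open>(a\<^sup>* - b c)\<^sup>* - b\<^sup>* (- c\<^sup>*) = a\<close>. Both \<open>tau1\<close> and \<open>tau2\<close> arise from it by composition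
  with permutations and signs.
\<close>
definition mutation :: "triple \<Rightarrow> triple"
  where "mutation = (\<lambda>(a, b, c). (star a - b * c, star b, - star c))"

lemma mutation_mutation: "mutation (mutation t) = t"
  by (cases t) (simp add: mutation_def star_diff star_mult star_star star_uminus)

lemma tau1_eq: "tau1 t = lambda_map 1 0 (sigma2 (sigma1 (mutation (sigma1 t))))"
  by (cases t) (simp add: tau1_def lambda_map_def sigma1_def sigma2_def mutation_def)

lemma tau2_eq: "tau2 t = sigma1 (mutation t)"
  by (cases t) (simp add: tau2_def sigma1_def mutation_def)

lemma sigma_sigma: "sigma1 (sigma1 t) = t" "sigma2 (sigma2 t) = t"
  by (cases t; simp add: sigma1_def sigma2_def)+

lemma neg_one_power_cases: "(- 1 :: laurent) ^ n = 1 \<or> (- 1 :: laurent) ^ n = - 1"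
  by (cases "even n") auto

lemma lambda_map_lambda_map: "lambda_map i j (lambda_map i j t) = t"
  using neg_one_power_cases[of i] neg_one_power_cases[of j]
  by (cases t) (auto simp: lambda_map_def power_add)

lemma mu_map_mu_map: "mu_map (- i) (- j) (mu_map i j t) = t"
  by (cases t) (simp add: mu_map_def s3_pow_mult s3_pow_0 flip: mult.assoc)

lemma sigma_lambda_map:
  "sigma1 (lambda_map i j t) = lambda_map (i + j) j (sigma1 t)"
  "sigma2 (lambda_map i j t) = lambda_map i (i + j) (sigma2 t)"
  using neg_one_power_cases[of i] neg_one_power_cases[of j]
  by (cases t; auto simp: lambda_map_def sigma1_def sigma2_def power_add)+

lemma sigma_mu_map:
  "sigma1 (mu_map i j t) = mu_map (- i - j) j (sigma1 t)"
  "sigma2 (mu_map i j t) = mu_map i (- i - j) (sigma2 t)"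
  by (cases t; simp add: mu_map_def sigma1_def sigma2_def)+

lemma mutation_lambda_map: "mutation (lambda_map i j t) = lambda_map i j (mutation t)"
  using neg_one_power_cases[of i] neg_one_power_cases[of j]
  by (cases t) (auto simp: lambda_map_def mutation_def power_add star_uminus)

lemma mutation_mu_map: "mutation (mu_map i j t) = mu_map (- i) (- j) (mutation t)"
proof -
  obtain a b c where t: "t = (a, b, c)" by (cases t)
  have "s3_pow (- i - j) * b * (s3_pow j * c) = (s3_pow (- i - j) * s3_pow j) * (b * c)"
    by (simp only: mult_ac)
  then show ?thesis
    by (simp add: t mu_map_def mutation_def star_mult star_s3_pow s3_pow_mult right_diff_distrib add.commute)
qed

lemma mutation_sigma2: "mutation (sigma2 t) = lambda_map 0 1 (sigma2 (mutation t))"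
  by (cases t) (simp add: lambda_map_def sigma2_def mutation_def mult.commute)

text \<open>
  Tropical form of the situation in which the first component is, up to the involution, the
  product of the other two. Mutating at this component leads back towards the initial solution,
  mutating at another component leads away from it.
\<close>
definition dominant_first :: "triple \<Rightarrow> bool"
  where "dominant_first = (\<lambda>(a, b, c). a \<noteq> 0 \<and> b \<noteq> 0 \<and> c \<noteq> 0 \<and>
    wdeg12 b > 0 \<and> wdeg21 b > 0 \<and> wdeg12 c > 0 \<and> wdeg21 c > 0 \<and>
    wdeg12 a = wdeg21 b + wdeg21 c \<and> wdeg21 a = wdeg12 b + wdeg12 c)"

lemma dominant_first_sigma2: "dominant_first (sigma2 t) \<longleftrightarrow> dominant_first t"
  by (cases t) (auto simp: dominant_first_def sigma2_def)

text \<open>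
  The hypothesis says that \<open>b\<close> is the dominant component. Then, for instance, the \<open>(1, 2, 0)\<close>-degree
  of \<open>b\<close> is that of \<open>a\<^sup>*\<close> plus a positive number, so \<open>b c\<close> exceeds \<open>a\<^sup>*\<close>.
\<close>
lemma mutation_product_dominates:
  assumes "dominant_first (sigma1 (a, b, c))"
  shows "star a - b * c \<noteq> 0" "wdeg12 (star a - b * c) = wdeg12 b + wdeg12 c"
    "wdeg21 (star a - b * c) = wdeg21 b + wdeg21 c"
proof -
  have nz: "b \<noteq> 0" "c \<noteq> 0" and pos: "wdeg12 c > 0" "wdeg21 c > 0"
    and b: "wdeg12 b = wdeg21 a + wdeg21 c" "wdeg21 b = wdeg12 a + wdeg12 c"
    using assms by (auto simp: dominant_first_def sigma1_def)
  have "wdeg12 (star a) < wdeg12 (b * c)" "wdeg21 (star a) < wdeg21 (b * c)"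
    using pos b by (simp_all add: wdegree_mult(2)[OF nz] wdeg_star)
  then show "star a - b * c \<noteq> 0" "wdeg12 (star a - b * c) = wdeg12 b + wdeg12 c"
    "wdeg21 (star a - b * c) = wdeg21 b + wdeg21 c"
    using wdegree_diff_dominated[OF wdegree_mult(1)[OF nz]] wdegree_mult(2)[OF nz] by auto
qed

lemma dominant_first_mutation:
  assumes "dominant_first (sigma1 t)"
  shows "dominant_first (mutation t)"
proof -
  obtain a b c where t: "t = (a, b, c)" by (cases t)
  have "b \<noteq> 0" "c \<noteq> 0" "wdeg12 c > 0" "wdeg21 c > 0" "wdeg12 b > 0" "wdeg21 b > 0"
    using assms by (auto simp: dominant_first_def sigma1_def t)
  then show ?thesis
    using mutation_product_dominates[of a b c] assms
    by (simp add: dominant_first_def mutation_def t star_eq_0_iff wdeg_star wdegree_uminus)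
qed

lemma initial_solution_eq:
  "initial_solution = (Poly_Mapping.single (1, 0, 0) 1, Poly_Mapping.single (1, 0, -1) 1,
     Poly_Mapping.single (1, 0, 0) 1)"
  by (simp add: initial_solution_def s1_def s3_pow_def mult_single)

lemma mutation_initial_solution:
  "mutation initial_solution = (Poly_Mapping.single (0, 1, -1) 1 - Poly_Mapping.single (2, 0, -1) 1,
     Poly_Mapping.single (0, 1, 0) 1, - Poly_Mapping.single (0, 1, -1) 1)"
  by (simp add: initial_solution_eq mutation_def star_single mult_single numeral_2_eq_2)

text \<open>
  The polynomial is \<open>(s\<^sub>2 - s\<^sub>1\<^sup>2)/s\<^sub>3\<close>. Its two terms tie for the weights \<open>(1, 2, 0)\<close>, so the general
  domination argument does not cover this first mutation.
\<close>
lemma wdeg_mutation_initial_solution: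
  defines "f \<equiv> Poly_Mapping.single (0, 1, -1) 1 - Poly_Mapping.single (2, 0, -1) 1 :: laurent"
  shows "f \<noteq> 0" "wdeg12 f = 2" "wdeg21 f = 4"
proof -
  have "e \<in> Poly_Mapping.keys f \<longleftrightarrow> e \<in> {(0, 1, -1), (2, 0, -1)}" for e
    by (cases e) (auto simp: f_def in_keys_iff lookup_minus lookup_single when_def)
  then have keys: "Poly_Mapping.keys f = {(0, 1, -1), (2, 0, -1)}" by blast
  then have "Poly_Mapping.keys f \<noteq> {}" by simp
  then show "f \<noteq> 0" by (simp only: keys_eq_empty not_False_eq_True)
  show "wdeg12 f = 2" "wdeg21 f = 4" by (simp_all add: wdegree_def keys weight_def)
qed

lemma dominant_first_mutation_initial_solution: "dominant_first (mutation initial_solution)"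
  unfolding mutation_initial_solution dominant_first_def
  using wdeg_mutation_initial_solution(1)
  by (simp add: wdeg_mutation_initial_solution wdegree_uminus wdegree_single weight_def
      del: One_nat_def)

section \<open>The Markov tree\<close>

text \<open>
  Mutations are admitted only where they lead away from the initial solution: there no leading
  term cancels, and invariants pass along by rule induction. Mutating at the first component
  with the second one dominant covers all such steps up to permutation.
\<close>
inductive markov_tree :: "triple \<Rightarrow> bool" where
  root: "markov_tree initial_solution"
| sigma1: "markov_tree t \<Longrightarrow> markov_tree (sigma1 t)"
| sigma2: "markov_tree t \<Longrightarrow> markov_tree (sigma2 t)"
| lambda: "markov_tree t \<Longrightarrow> markov_tree (lambda_map i j t)"
| mu: "markov_tree t \<Longrightarrow> markov_tree (mu_map i j t)"
| ascend: "markov_tree t \<Longrightarrow> t = initial_solution \<or> dominant_first (sigma1 t) \<Longrightarrow>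
    markov_tree (mutation t)"

text \<open>
  A triple obtained by an ascending mutation has its new component dominant. Mutating it again
  at this component gives back the previous triple, and at the two others it ascends. The three
  mutations of the initial solution agree up to permutations, signs and powers of \<open>s\<^sub>3\<close>. Changing a
  triple by such maps changes its three mutations only by such maps and permutes them. The
  permutations in the statement bring each of the three components to the front.
\<close>
lemma markov_tree_mutations:
  assumes "markov_tree t"
  shows "markov_tree (mutation t) \<and> markov_tree (mutation (sigma1 t)) \<and>
    markov_tree (mutation (sigma1 (sigma2 t)))"
  using assms
proof induction
  case root
  have m: "markov_tree (mutation initial_solution)"
    by (intro markov_tree.intros) simp
  have "mutation (sigma1 initial_solution) = mu_map 1 0 (mutation initial_solution)"
    by (simp add: mutation_initial_solution)
       (simp add: initial_solution_eq mutation_def sigma1_def mu_map_def star_single mult_single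
         s3_pow_def right_diff_distrib)
  moreover have "sigma1 (sigma2 initial_solution) = sigma2 initial_solution"
    by (simp add: initial_solution_def sigma1_def sigma2_def)
  ultimately show ?case using m markov_tree.intros by (simp add: mutation_sigma2)
next
  case (sigma1 t)
  have "sigma1 (sigma2 (sigma1 t)) = sigma2 (sigma1 (sigma2 t))"
    by (cases t) (simp add: sigma1_def sigma2_def)
  then show ?case using sigma1 markov_tree.intros by (simp add: sigma_sigma mutation_sigma2)
next
  case (sigma2 t)
  then show ?case using markov_tree.intros by (simp add: sigma_sigma mutation_sigma2)
next
  case (lambda t i j)
  then show ?case using markov_tree.intros by (simp add: mutation_lambda_map sigma_lambda_map)
next
  case (mu t i j)
  then show ?case using markov_tree.intros by (simp add: mutation_mu_map sigma_mu_map)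
next
  case (ascend t)
  let ?u = "mutation t"
  have u: "markov_tree ?u" using ascend markov_tree.intros by blast
  have dom: "dominant_first ?u"
    using ascend dominant_first_mutation dominant_first_mutation_initial_solution by blast
  have "markov_tree (mutation (sigma1 ?u))"
    by (rule markov_tree.ascend) (use u dom in \<open>auto simp: sigma_sigma intro: markov_tree.sigma1\<close>)
  moreover have "markov_tree (mutation (sigma1 (sigma2 ?u)))"
    by (rule markov_tree.ascend)
       (use u dom in \<open>auto simp: sigma_sigma dominant_first_sigma2
          intro: markov_tree.sigma1 markov_tree.sigma2\<close>)
  ultimately show ?case using \<open>markov_tree t\<close> by (simp only: mutation_mutation simp_thms)
qed

lemma markov_tree_iff:
  "markov_tree (sigma1 t) \<longleftrightarrow> markov_tree t" "markov_tree (sigma2 t) \<longleftrightarrow> markov_tree t"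
  "markov_tree (lambda_map i j t) \<longleftrightarrow> markov_tree t" "markov_tree (mu_map k l t) \<longleftrightarrow> markov_tree t"
  "markov_tree (mutation t) \<longleftrightarrow> markov_tree t"
  using markov_tree.intros(2-5) markov_tree_mutations
  by (metis sigma_sigma lambda_map_lambda_map mu_map_mu_map mutation_mutation)+

lemma markov_tree_generator_iff:
  assumes "g \<in> Gamma_generators"
  shows "markov_tree (g t) \<longleftrightarrow> markov_tree t"
  using assms unfolding Gamma_generators_def
  by (auto simp: tau1_eq tau2_eq markov_tree_iff)

text \<open>
  Inverses of generators are covered because membership in the tree is equivalent before and
  after a generator acts.
\<close>
lemma Gamma_M_preserves_markov_tree:
  assumes "g \<in> Gamma_M" "markov_tree t"
  shows "markov_tree (g t)"
  using assms unfolding Gamma_M_def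
proof (induction arbitrary: t)
  case one
  then show ?case by (simp add: BijGroup_def)
next
  case (incl g)
  then show ?case by (simp add: markov_tree_generator_iff)
next
  case (inv g)
  have g: "g \<in> Bij UNIV"
    using inv(1) Gamma_generators_subset by (auto simp: BijGroup_def)
  then have "g ((inv\<^bsub>BijGroup UNIV\<^esub> g) t) = t"
    by (simp add: inv_BijGroup Bij_def bij_betw_def surj_f_inv_f)
  then show ?case using inv markov_tree_generator_iff by metis
next
  case (eng g h)
  interpret group "BijGroup (UNIV :: triple set)" by (rule group_BijGroup)
  have "g \<in> carrier (BijGroup UNIV)" "h \<in> carrier (BijGroup UNIV)"
    using generate_in_carrier[OF Gamma_generators_subset] eng(1,2) by blast+
  then have "(g \<otimes>\<^bsub>BijGroup UNIV\<^esub> h) t = g (h t)"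
    by (simp add: BijGroup_def compose_def)
  then show ?case using eng by metis
qed

lemma Gamma_orbit_markov_tree: "t \<in> Gamma_orbit \<Longrightarrow> markov_tree t"
  unfolding Gamma_orbit_def orbit_def
  using Gamma_M_preserves_markov_tree[OF _ markov_tree.root] by fastforce

text \<open>
  The weights of a triple have sum zero, as those of \<open>(s\<^sub>1, s\<^sub>1/s\<^sub>3, s\<^sub>1)\<close>, which are \<open>1, -2, 1\<close>. This is
  what makes the two terms \<open>a\<^sup>*\<close> and \<open>b c\<close> of a mutation homogeneous of the same weight.
\<close>
definition balanced :: "triple \<Rightarrow> bool"
  where "balanced = (\<lambda>(a, b, c).
    (\<exists>p r. homogeneous_of_weight p a \<and> homogeneous_of_weight r b \<and> homogeneous_of_weight (- p - r) c) \<and>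
    (\<forall>f \<in> {a, b, c}. f \<noteq> 0 \<and> \<bar>defect f\<bar> \<in> {1, 2}))"

text \<open>
  If \<open>b\<close> is dominant, its defect is minus the sum of the defects of \<open>a\<close> and \<open>c\<close>. The new component
  has the defect of \<open>b c\<close>, which is therefore minus that of \<open>a\<close>; the other two components are
  replaced by their images under the involution. So all defects change sign.
\<close>
lemma balanced_mutation:
  assumes "balanced t" "dominant_first (sigma1 t)"
  shows "balanced (mutation t)"
proof -
  obtain a b c where t: "t = (a, b, c)" by (cases t)
  obtain p r where hom: "homogeneous_of_weight p a" "homogeneous_of_weight r b"
    "homogeneous_of_weight (- p - r) c"
    using assms(1) by (auto simp: balanced_def t)
  have "homogeneous_of_weight (- p) (b * c)"
    using homogeneous_of_weight_mult[OF hom(2,3)] by simp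
  then have "homogeneous_of_weight (- p) (star a - b * c)"
    by (intro homogeneous_of_weight_diff homogeneous_of_weight_star hom)
  moreover have "homogeneous_of_weight (- r) (star b)"
    "homogeneous_of_weight (- (- p) - (- r)) (- star c)"
    using hom(2) homogeneous_of_weight_star[OF hom(3)]
    by (simp_all add: homogeneous_of_weight_star homogeneous_of_weight_uminus add.commute)
  moreover have "defect (star a - b * c) = - defect a"
    using mutation_product_dominates(2,3)[of a b c] assms(2)
    by (simp add: defect_def t dominant_first_def sigma1_def)
  moreover have "star a - b * c \<noteq> 0"
    using mutation_product_dominates(1)[of a b c] assms(2) by (simp add: t)
  ultimately have "\<exists>p r. homogeneous_of_weight p (star a - b * c) \<and>
      homogeneous_of_weight r (star b) \<and> homogeneous_of_weight (- p - r) (- star c)"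
    and "star a - b * c \<noteq> 0" "defect (star a - b * c) = - defect a"
    by blast+
  then show ?thesis
    using assms(1) unfolding balanced_def mutation_def t
    by (simp add: star_eq_0_iff defect_star defect_uminus)
qed

lemma sign_mult_invariance:
  "homogeneous_of_weight p ((- 1) ^ n * f) \<longleftrightarrow> homogeneous_of_weight p f"
  "defect ((- 1) ^ n * f) = defect f"
  "(- 1) ^ n * f = 0 \<longleftrightarrow> f = (0 :: laurent)"
  using neg_one_power_cases[of n] by (auto simp: homogeneous_of_weight_uminus defect_uminus)

lemma balanced_initial_solution: "balanced initial_solution"
proof -
  have "homogeneous_of_weight 1 (Poly_Mapping.single (1, 0, 0) 1)"
    "homogeneous_of_weight (- 2) (Poly_Mapping.single (1, 0, -1) 1)"
    using homogeneous_of_weight_single[of "(1, 0, 0)" 1] homogeneous_of_weight_single[of "(1, 0, -1)" 1]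
    by (simp_all add: weight_def)
  then have "\<exists>p r. homogeneous_of_weight p (Poly_Mapping.single (1, 0, 0) 1) \<and>
      homogeneous_of_weight r (Poly_Mapping.single (1, 0, -1) 1) \<and>
      homogeneous_of_weight (- p - r) (Poly_Mapping.single (1, 0, 0) 1)"
    by (intro exI[of _ 1] exI[of _ "- 2"]) simp
  then show ?thesis
    by (simp add: balanced_def initial_solution_eq defect_def wdegree_single weight_def)
qed

lemma balanced_mutation_initial_solution: "balanced (mutation initial_solution)"
proof -
  have hom: "homogeneous_of_weight (- 1) (Poly_Mapping.single (0, 1, -1) 1)"
    "homogeneous_of_weight (- 1) (Poly_Mapping.single (2, 0, -1) 1)"
    "homogeneous_of_weight 2 (Poly_Mapping.single (0, 1, 0) 1)"
    by (simp_all add: homogeneous_of_weight_def weight_def)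
  have "\<exists>p r. homogeneous_of_weight p
        (Poly_Mapping.single (0, 1, -1) 1 - Poly_Mapping.single (2, 0, -1) 1) \<and>
      homogeneous_of_weight r (Poly_Mapping.single (0, 1, 0) 1) \<and>
      homogeneous_of_weight (- p - r) (- Poly_Mapping.single (0, 1, -1) 1)"
    by (rule exI[of _ "- 1"], rule exI[of _ 2])
       (use hom in \<open>simp add: homogeneous_of_weight_diff homogeneous_of_weight_uminus
          del: One_nat_def\<close>)
  then show ?thesis
    unfolding balanced_def mutation_initial_solution
    using wdeg_mutation_initial_solution(1)
    by (simp add: wdeg_mutation_initial_solution defect_def wdegree_uminus wdegree_single
        weight_def del: One_nat_def)
qed

lemma markov_tree_balanced: "markov_tree t \<Longrightarrow> balanced t"
proof (induction rule: markov_tree.induct)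
  case root
  show ?case by (rule balanced_initial_solution)
next
  case (sigma1 t)
  obtain a b c where t: "t = (a, b, c)" by (cases t)
  have "\<exists>p r. homogeneous_of_weight p b \<and> homogeneous_of_weight r a \<and> homogeneous_of_weight (- p - r) c"
    using sigma1(2) unfolding balanced_def t prod.case by (metis diff_conv_add_uminus add.commute)
  then show ?case using sigma1(2) by (auto simp: balanced_def t sigma1_def)
next
  case (sigma2 t)
  obtain a b c where t: "t = (a, b, c)" by (cases t)
  obtain p r where "homogeneous_of_weight p a" "homogeneous_of_weight r b"
    "homogeneous_of_weight (- p - r) c"
    using sigma2(2) by (auto simp: balanced_def t)
  then have "\<exists>p r. homogeneous_of_weight p a \<and> homogeneous_of_weight r c \<and> homogeneous_of_weight (- p - r) b"
    by (intro exI[of _ p] exI[of _ "- p - r"]) simp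
  then show ?case using sigma2(2) by (auto simp: balanced_def t sigma2_def)
next
  case (lambda t i j)
  show ?case
    using lambda(2) by (cases t) (simp add: balanced_def lambda_map_def sign_mult_invariance)
next
  case (mu t i j)
  obtain a b c where t: "t = (a, b, c)" by (cases t)
  obtain p r where "homogeneous_of_weight p a" "homogeneous_of_weight r b"
    "homogeneous_of_weight (- p - r) c"
    using mu(2) by (auto simp: balanced_def t)
  note this[THEN homogeneous_of_weight_s3_pow_mult]
  from this(1)[of i] this(2)[of "- i - j"] this(3)[of j]
  have "\<exists>p r. homogeneous_of_weight p (s3_pow i * a) \<and> homogeneous_of_weight r (s3_pow (- i - j) * b) \<and>
      homogeneous_of_weight (- p - r) (s3_pow j * c)"
    by (intro exI[of _ "3 * i + p"] exI[of _ "3 * (- i - j) + r"]) (simp add: algebra_simps)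
  then show ?case
    using mu(2) by (auto simp: balanced_def t mu_map_def s3_pow_mult_eq_0_iff defect_s3_pow_mult)
next
  case (ascend t)
  then show ?case using balanced_mutation balanced_mutation_initial_solution by blast
qed

lemma star_markov_polynomial_defect:
  assumes "star_markov_polynomial f"
  shows "quasi_homogeneous (1, 2, 3) f" and "\<bar>defect f\<bar> \<in> {1, 2}"
proof -
  have "quasi_homogeneous (1, 2, 3) f \<and> \<bar>defect f\<bar> \<in> {1, 2}"
  proof (cases "f = s2")
    case True
    then show ?thesis
      by (simp add: s2_def quasi_homogeneous_def defect_def wdegree_single weight_def)
  next
    case False
    then obtain f1 f3 where "(star f1, f, star f3) \<in> Gamma_orbit"
      using assms by (auto simp: star_markov_polynomial_def)
    then have "balanced (star f1, f, star f3)"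
      by (intro markov_tree_balanced Gamma_orbit_markov_tree)
    then show ?thesis by (auto simp: balanced_def quasi_homogeneous_iff)
  qed
  then show "quasi_homogeneous (1, 2, 3) f" "\<bar>defect f\<bar> \<in> {1, 2}" by auto
qed

lemma star_markov_polynomial_reduced:
  assumes "star_markov_polynomial f"
  shows "f \<in> polynomials" "\<not> divisible_by_s3 f"
proof -
  have "s2 \<in> polynomials" by (simp add: s2_def polynomials_def)
  moreover have "\<not> divisible_by_s3 s2"
  proof
    assume "divisible_by_s3 s2"
    then obtain g where g: "g \<in> polynomials" "s2 = s3 * g" by (auto simp: divisible_by_s3_def)
    have "(0, 1, 0) \<in> Poly_Mapping.keys (s3 * g)" by (simp add: g(2)[symmetric] s2_def)
    then have "(0, 1, 0) \<in> {a + b |a b. a \<in> Poly_Mapping.keys s3 \<and> b \<in> Poly_Mapping.keys g}"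
      using keys_mult[of s3 g] by blast
    then show False using g(1) by (auto simp: s3_pow_def polynomials_def)
  qed
  ultimately show "f \<in> polynomials" "\<not> divisible_by_s3 f"
    using assms by (auto simp: star_markov_polynomial_def reduced_polynomial_presentation_def
        reduced_polynomial_solution_def)
qed

theorem theorem1p3:
  fixes f :: laurent and d q :: int
  assumes "star_markov_polynomial f \<or> dual_star_markov_polynomial f"
    and "bidegree f = (d, q)"
  shows "quasi_homogeneous (1, 2, 3) f \<and>
    (odd d \<longrightarrow> \<bar>2 * q - 3 * d\<bar> = 1) \<and>
    (even d \<longrightarrow> \<bar>2 * q - 3 * d\<bar> = 2)"
proof -
  have "f \<in> polynomials \<and> \<not> divisible_by_s3 f \<and> quasi_homogeneous (1, 2, 3) f \<and> \<bar>defect f\<bar> \<in> {1, 2}"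
    using assms(1)
  proof
    assume "star_markov_polynomial f"
    then show ?thesis using star_markov_polynomial_defect star_markov_polynomial_reduced by auto
  next
    assume dual: "dual_star_markov_polynomial f"
    \<comment> \<open>Recover \<open>f\<close> from its dual by undoing the power of \<open>s\<^sub>3\<close> and applying the involution.\<close>
    define k where "k = wdegree (1, 1, 1) f"
    have g: "star_markov_polynomial (s3_pow k * star f)"
      using dual by (simp add: dual_star_markov_polynomial_def mu_dual_def k_def)
    have f_eq: "f = star (s3_pow (- k) * (s3_pow k * star f))"
      by (simp add: s3_pow_mult s3_pow_0 star_star flip: mult.assoc)
    have "quasi_homogeneous (1, 2, 3) f"
      using star_markov_polynomial_defect(1)[OF g] homogeneous_of_weight_star
        homogeneous_of_weight_s3_pow_mult f_eq unfolding quasi_homogeneous_iff by metis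
    moreover have "\<bar>defect f\<bar> \<in> {1, 2}"
      using star_markov_polynomial_defect(2)[OF g] by (simp add: defect_s3_pow_mult defect_star)
    ultimately show ?thesis using dual by (simp add: dual_star_markov_polynomial_def)
  qed
  then have "quasi_homogeneous (1, 2, 3) f" and "\<bar>2 * q - 3 * d\<bar> = 1 \<or> \<bar>2 * q - 3 * d\<bar> = 2"
    using defect_eq_bidegree[OF _ _ _ assms(2)] by auto
  moreover have "odd d" if "\<bar>2 * q - 3 * d\<bar> = 1" using that by presburger
  moreover have "even d" if "\<bar>2 * q - 3 * d\<bar> = 2" using that by presburger
  ultimately show ?thesis by blast
qed

end
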